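(* Let $n_{\mathcal G}$ and $k_{\mathcal G}$ be positive integers with $k_{\mathcal G}=n_{\mathcal G}-1$, and let $n_{\mathcal H}=3$, $k_{\mathcal H}=2$. Put $\alpha=\sqrt2\,(n_{\mathcal G}-1)$, $\beta=-\tfrac23\sqrt2$, $\gamma=\tfrac13\sqrt2$, and define $$s_0=\alpha+\beta\Bigl(\sum_{g\in V(\mathcal G)}\sum_{h\in V(\mathcal H)}x_{gh}\Bigr)+\gamma\Bigl(\sum_{g\in V(\mathcal G)}\ \sum_{\{h,h'\}\subseteq V(\mathcal H)}x_{gh}x_{gh'}\Bigr),$$ $$s_g=\frac13\Bigl(\sum_{h\in V(\mathcal H)}x_{gh}-2\sum_{\{h,h'\}\subseteq V(\mathcal H)}x_{gh}x_{gh'}\Bigr)\qquad\text{for } g\in V(\mathcal G),$$ where the inner sums run over all 2-element subsets $\{h,h'\}$ of $V(\mathcal H)$. Then these polynomials are a sum-of-squares certificate of degree $2$ for $f^{*}=\bigl(\sum_{g\in V(\mathcal G),h\in V(\mathcal H)}x_{gh}\bigr)-k_{\mathcal G}k_{\mathcal H}$, i.e. $$f^{*}\equiv s_0^2+\sum_{g\in V(\mathcal G)}s_g^2 \mod I_{\mathrm{sos}}.$$ Consequently Vizing's conjecture holds for these parameters: $\gamma(G)\gamma(H)\le\gamma(G\Box H)$ for all graphs $G$ on $n_{\mathcal G}$ vertices with domination number $k_{\mathcal G}=n_{\mathcal G}-1$ and all graphs $H$ on $3$ vertices with domination number $2$.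
   Context: Graphs are finite and simple. A set $D\subseteq V(G)$ is dominating in $G$ if every vertex of $V(G)\setminus D$ is adjacent to some vertex of $D$; the domination number $\gamma(G)$ is the minimum size of a dominating set (not to be confused with the scalar $\gamma$). The Cartesian product $G\Box H$ has vertex set $V(G)\times V(H)$, with $gh$ and $g'h'$ adjacent iff ($g=g'$ and $hh'\in E(H)$) or ($h=h'$ and $gg'\in E(G)$). Let $\mathbb K\subseteq\mathbb R$ be a field with $\sqrt2\in\mathbb K$. Given positive integers $k_{\mathcal G}\le n_{\mathcal G}$ and $k_{\mathcal H}\le n_{\mathcal H}$, fix a set $V(\mathcal G)$ of $n_{\mathcal G}$ vertices with a fixed subset $D_{\mathcal G}$ of size $k_{\mathcal G}$, and a set $V(\mathcal H)$ of $n_{\mathcal H}$ vertices with a fixed subset $D_{\mathcal H}$ of size $k_{\mathcal H}$. Introduce variables $e_{gg'}=e_{g'g}$ for each 2-element subset $\{g,g'\}\subseteq V(\mathcal G)$, variables $e_{hh'}=e_{h'h}$ for each 2-element subset $\{h,h'\}\subseteq V(\mathcal H)$, and variables $x_{gh}$ for $g\in V(\mathcal G)$, $h\in V(\mathcal H)$ (all distinct). Let $P$ be the polynomial ring over $\mathbb K$ in all these variables. The ideal $I_{\mathrm{sos}}\subseteq P$ is generated by the following polynomials: - $e_{gg'}^2-e_{gg'}$ for $\{g,g'\}\subseteq V(\mathcal G)$; $\prod_{g'\in D_{\mathcal G}}(1-e_{gg'})$ for $g\in V(\mathcal G)\setminus D_{\mathcal G}$; $\prod_{g'\in V(\mathcal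 G)\setminus S}\bigl(\sum_{g\in S}e_{gg'}\bigr)$ for $S\subseteq V(\mathcal G)$ with $|S|=k_{\mathcal G}-1$; - the same three families with $\mathcal H$ in place of $\mathcal G$ (variables $e_{hh'}$, set $D_{\mathcal H}$, size $k_{\mathcal H}$); - $x_{gh}^2-x_{gh}$ and $(1-x_{gh})\prod_{g'\in V(\mathcal G),\,g'\ne g}(1-e_{gg'}x_{g'h})\prod_{h'\in V(\mathcal H),\,h'\neq h}(1-e_{hh'}x_{gh'})$ for $g\in V(\mathcal G)$, $h\in V(\mathcal H)$. *)

theory Defs
  imports
    Complex_Main
    "HOL-Library.Poly_Mapping"
    "HOL-Library.Ramsey"
    "HOL-Algebra.Algebraic_Closure_Type"
    "Graph_Theory.Graph_Theory"
begin

section \<open>Domination in finite simple graphs\<close>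

text \<open>
  A finite simple graph is a \<^locale>\<open>pair_graph\<close>: finitely many vertices, and a symmetric
  irreflexive arc relation, so that \<open>u\<close> and \<open>v\<close> are adjacent iff \<open>(u, v) \<in> parcs G\<close>.
\<close>

definition dominating :: "'a pair_pre_digraph \<Rightarrow> 'a set \<Rightarrow> bool" where
  "dominating G D \<longleftrightarrow>
     D \<subseteq> pverts G \<and> (\<forall>v \<in> pverts G - D. \<exists>u\<in>D. (v, u) \<in> parcs G)"

definition domination_number :: "'a pair_pre_digraph \<Rightarrow> nat" where
  "domination_number G = Min (card ` {D. dominating G D})"

definition cartesian_product ::
    "'a pair_pre_digraph \<Rightarrow> 'b pair_pre_digraph \<Rightarrow> ('a \<times> 'b) pair_pre_digraph"
    (infixl \<open>\<box>\<close> 70) where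
  "G \<box> H =
     \<lparr> pverts = pverts G \<times> pverts H,
       parcs = {((g, h), (g', h')) | g h g' h'.
         (g = g' \<and> g \<in> pverts G \<and> (h, h') \<in> parcs H) \<or>
         (h = h' \<and> h \<in> pverts H \<and> (g, g') \<in> parcs G)} \<rparr>"

lemma pair_graph_cartesian_product:
  assumes "pair_graph G" "pair_graph H"
  shows "pair_graph (G \<box> H)"
proof -
  interpret G: pair_graph G by fact
  interpret H: pair_graph H by fact
  have fin: "finite (parcs (G \<box> H))"
  proof (rule finite_subset)
    show "parcs (G \<box> H) \<subseteq> (pverts G \<times> pverts H) \<times> (pverts G \<times> pverts H)"
      using G.in_arcsD1 G.in_arcsD2 H.in_arcsD1 H.in_arcsD2
      by (auto simp: cartesian_product_def)
  qed (simp add: G.pair_finite_verts H.pair_finite_verts)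
  have sG: "(v, u) \<in> parcs G" if "(u, v) \<in> parcs G" for u v
    using G.pair_sym_arcs that by (auto simp: symmetric_def sym_def)
  have sH: "(v, u) \<in> parcs H" if "(u, v) \<in> parcs H" for u v
    using H.pair_sym_arcs that by (auto simp: symmetric_def sym_def)
  show ?thesis
  proof
    show "symmetric (with_proj (G \<box> H))"
      using sG sH by (auto simp: symmetric_def sym_def cartesian_product_def)
  next
    fix e assume "e \<in> parcs (G \<box> H)"
    then show "fst e \<noteq> snd e"
      using G.pair_no_loops H.pair_no_loops by (fastforce simp: cartesian_product_def)
  qed (use fin G.pair_finite_verts H.pair_finite_verts G.in_arcsD1 G.in_arcsD2
         H.in_arcsD1 H.in_arcsD2 in \<open>auto simp: cartesian_product_def\<close>)
qed

section \<open>Polynomials over a subfield of the reals\<close>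

text \<open>A monomial is its finitely supported exponent vector.\<close>

type_synonym 'v rpoly = "('v \<Rightarrow>\<^sub>0 nat) \<Rightarrow>\<^sub>0 real"

definition PVar :: "'v \<Rightarrow> 'v rpoly" where
  "PVar v = Poly_Mapping.single (Poly_Mapping.single v 1) 1"

definition PConst :: "real \<Rightarrow> 'v rpoly" where
  "PConst c = Poly_Mapping.single 0 c"

definition total_degree :: "'v rpoly \<Rightarrow> nat" where
  "total_degree p =
     Max (insert 0 ((\<lambda>m. \<Sum>v\<in>Poly_Mapping.keys m. Poly_Mapping.lookup m v) ` Poly_Mapping.keys p))"

definition polys_over :: "real set \<Rightarrow> 'v set \<Rightarrow> 'v rpoly set" where
  "polys_over K V =
     {p. \<forall>m \<in> Poly_Mapping.keys p. Poly_Mapping.lookup p m \<in> K \<and> Poly_Mapping.keys m \<subseteq> V}"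

text \<open>The polynomial ring \<open>K[V]\<close>, where \<open>V\<close> need not exhaust the type of variables.\<close>

definition mpoly_ring :: "real set \<Rightarrow> 'v set \<Rightarrow> 'v rpoly ring" where
  "mpoly_ring K V = ring_of_type_algebra\<lparr> carrier := polys_over K V \<rparr>"

lemma real_subringD:
  assumes "subring K (ring_of_type_algebra :: real ring)"
  shows "0 \<in> K" "1 \<in> K" "a \<in> K \<Longrightarrow> b \<in> K \<Longrightarrow> a + b \<in> K"
    "a \<in> K \<Longrightarrow> b \<in> K \<Longrightarrow> a * b \<in> K" "a \<in> K \<Longrightarrow> - a \<in> K"
proof -
  let ?R = "ring_of_type_algebra :: real ring"
  interpret cring ?R by (rule cring_from_type_algebra)
  have neg: "\<ominus>\<^bsub>?R\<^esub> a = - a" for a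
    by (rule minus_equality) (auto simp: ring_of_type_algebra_def)
  show "0 \<in> K" "1 \<in> K" "a \<in> K \<Longrightarrow> b \<in> K \<Longrightarrow> a + b \<in> K" "a \<in> K \<Longrightarrow> b \<in> K \<Longrightarrow> a * b \<in> K"
    using subringE[OF assms] by (auto simp: ring_of_type_algebra_def)
  show "a \<in> K \<Longrightarrow> - a \<in> K"
    using subringE(5)[OF assms, of a] neg by simp
qed

context
  fixes K :: "real set"
  assumes K: "subring K (ring_of_type_algebra :: real ring)"
begin

lemma polys_over_lookup: "p \<in> polys_over K V \<Longrightarrow> Poly_Mapping.lookup p m \<in> K"
  by (cases "m \<in> Poly_Mapping.keys p")
    (auto simp: polys_over_def in_keys_iff real_subringD[OF K])

lemma polys_over_single:
  "c \<in> K \<Longrightarrow> Poly_Mapping.keys m \<subseteq> V \<Longrightarrow> Poly_Mapping.single m c \<in> polys_over K V"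
  by (auto simp: polys_over_def split: if_splits)

lemma polys_over_add:
  assumes "p \<in> polys_over K V" "q \<in> polys_over K V"
  shows "p + q \<in> polys_over K V"
  unfolding polys_over_def
proof (intro CollectI ballI conjI)
  fix m assume m: "m \<in> Poly_Mapping.keys (p + q)"
  show "Poly_Mapping.lookup (p + q) m \<in> K"
    using assms by (simp add: lookup_add polys_over_lookup real_subringD[OF K])
  show "Poly_Mapping.keys m \<subseteq> V"
    using m keys_add[of p q] assms by (auto simp: polys_over_def)
qed

lemma polys_over_uminus: "p \<in> polys_over K V \<Longrightarrow> - p \<in> polys_over K V"
  by (auto simp: polys_over_def in_keys_iff real_subringD[OF K])

lemma polys_over_diff: "p \<in> polys_over K V \<Longrightarrow> q \<in> polys_over K V \<Longrightarrow> p - q \<in> polys_over K V"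
  using polys_over_add[of p V "- q"] polys_over_uminus[of q V] by simp

lemma polys_over_0: "0 \<in> polys_over K V"
  by (simp add: polys_over_def)

lemma polys_over_1: "1 \<in> polys_over K V"
  using polys_over_single[of 1 0 V] by (simp add: real_subringD[OF K] flip: single_one)

lemma polys_over_sum: "(\<And>i. i \<in> A \<Longrightarrow> p i \<in> polys_over K V) \<Longrightarrow> sum p A \<in> polys_over K V"
  by (induction A rule: infinite_finite_induct) (auto intro: polys_over_0 polys_over_add)

lemma polys_over_mult:
  assumes "p \<in> polys_over K V" "q \<in> polys_over K V"
  shows "p * q \<in> polys_over K V"
proof -
  let ?mono = "\<lambda>r m. Poly_Mapping.single m (Poly_Mapping.lookup r m)"
  have expand: "r = (\<Sum>m\<in>Poly_Mapping.keys r. ?mono r m)" for r :: "'a rpoly"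
    by (rule poly_mapping_eqI) (auto simp: lookup_sum lookup_single when_def in_keys_iff)
  have "(\<Sum>m\<in>Poly_Mapping.keys p. \<Sum>n\<in>Poly_Mapping.keys q. ?mono p m * ?mono q n) \<in> polys_over K V"
  proof (intro polys_over_sum)
    fix m n assume "m \<in> Poly_Mapping.keys p" "n \<in> Poly_Mapping.keys q"
    then have "Poly_Mapping.keys (m + n) \<subseteq> V"
      using assms keys_add[of m n] unfolding polys_over_def by blast
    then show "?mono p m * ?mono q n \<in> polys_over K V"
      unfolding mult_single
      using assms by (intro polys_over_single real_subringD[OF K] polys_over_lookup)
  qed
  also have "(\<Sum>m\<in>Poly_Mapping.keys p. \<Sum>n\<in>Poly_Mapping.keys q. ?mono p m * ?mono q n) = p * q"
    unfolding sum_product[symmetric] expand[symmetric] ..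
  finally show ?thesis .
qed

lemma polys_over_prod: "(\<And>i. i \<in> A \<Longrightarrow> p i \<in> polys_over K V) \<Longrightarrow> prod p A \<in> polys_over K V"
  by (induction A rule: infinite_finite_induct) (auto intro: polys_over_1 polys_over_mult)

lemma polys_over_power: "p \<in> polys_over K V \<Longrightarrow> p ^ n \<in> polys_over K V"
  by (induction n) (auto intro: polys_over_1 polys_over_mult)

lemma polys_over_PVar: "v \<in> V \<Longrightarrow> PVar v \<in> polys_over K V"
  unfolding PVar_def by (intro polys_over_single real_subringD[OF K]) auto

lemma cring_mpoly_ring: "cring (mpoly_ring K V)"
proof -
  let ?R = "ring_of_type_algebra :: 'v rpoly ring"
  interpret cring ?R by (rule cring_from_type_algebra)
  have neg: "\<ominus>\<^bsub>?R\<^esub> p = - p" for p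
    by (rule minus_equality) (auto simp: ring_of_type_algebra_def)
  have "subring (polys_over K V) ?R"
    by (rule subringI) (simp_all only: neg,
        auto simp: ring_of_type_algebra_def polys_over_1 polys_over_uminus polys_over_mult polys_over_add)
  then show ?thesis
    unfolding mpoly_ring_def
    using subcring_iff[of "polys_over K V"] subcringI' subringE(1) by blast
qed

end

text \<open>
  \<open>sos_certificate R I l f A s\<close>: the family \<open>(s i)\<close>, \<open>i \<in> A\<close>, of elements of \<open>R\<close> of degree at
  most \<open>l\<close> witnesses that \<open>f\<close> is a sum of squares modulo the ideal \<open>I\<close>.
\<close>

definition sos_certificate ::
    "'v rpoly ring \<Rightarrow> 'v rpoly set \<Rightarrow> nat \<Rightarrow> 'v rpoly \<Rightarrow> 'i set \<Rightarrow> ('i \<Rightarrow> 'v rpoly) \<Rightarrow> bool" where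
  "sos_certificate R I l f A s \<longleftrightarrow>
     finite A \<and> (\<forall>i\<in>A. s i \<in> carrier R \<and> total_degree (s i) \<le> l) \<and> f - (\<Sum>i\<in>A. (s i)\<^sup>2) \<in> I"

section \<open>The ideal of Vizing's conjecture\<close>

text \<open>
  \<open>EG {g, g'}\<close>, \<open>EH {h, h'}\<close> and \<open>XV g h\<close> index the variables \<open>e\<^sub>g\<^sub>g\<^sub>'\<close>, \<open>e\<^sub>h\<^sub>h\<^sub>'\<close> and \<open>x\<^sub>g\<^sub>h\<close>;
  edge variables being indexed by sets makes them symmetric.
\<close>

datatype ('a, 'b) vvar = EG "'a set" | EH "'b set" | XV 'a 'b

definition vizing_vars :: "'a set \<Rightarrow> 'b set \<Rightarrow> ('a, 'b) vvar set" where
  "vizing_vars VG VH =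
     EG ` nsets VG 2 \<union> EH ` nsets VH 2 \<union> {XV g h | g h. g \<in> VG \<and> h \<in> VH}"

abbreviation vizing_ring :: "real set \<Rightarrow> 'a set \<Rightarrow> 'b set \<Rightarrow> ('a, 'b) vvar rpoly ring" where
  "vizing_ring K VG VH \<equiv> mpoly_ring K (vizing_vars VG VH)"

abbreviation eG :: "'a \<Rightarrow> 'a \<Rightarrow> ('a, 'b) vvar rpoly" where
  "eG g g' \<equiv> PVar (EG {g, g'})"

abbreviation eH :: "'b \<Rightarrow> 'b \<Rightarrow> ('a, 'b) vvar rpoly" where
  "eH h h' \<equiv> PVar (EH {h, h'})"

abbreviation xv :: "'a \<Rightarrow> 'b \<Rightarrow> ('a, 'b) vvar rpoly" where
  "xv g h \<equiv> PVar (XV g h)"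

definition graph_gens :: "('c \<Rightarrow> 'c \<Rightarrow> 'v rpoly) \<Rightarrow> 'c set \<Rightarrow> 'c set \<Rightarrow> nat \<Rightarrow> 'v rpoly set" where
  "graph_gens e V D k =
     {(e g g')\<^sup>2 - e g g' | g g'. g \<in> V \<and> g' \<in> V \<and> g \<noteq> g'} \<union>
     {\<Prod>g'\<in>D. 1 - e g g' | g. g \<in> V - D} \<union>
     {\<Prod>g'\<in>V - S. \<Sum>g\<in>S. e g g' | S. S \<subseteq> V \<and> card S = k - 1}"

definition product_gens :: "'a set \<Rightarrow> 'b set \<Rightarrow> ('a, 'b) vvar rpoly set" where
  "product_gens VG VH =
     {(xv g h)\<^sup>2 - xv g h | g h. g \<in> VG \<and> h \<in> VH} \<union>
     {(1 - xv g h) * (\<Prod>g'\<in>VG - {g}. 1 - eG g g' * xv g' h) * (\<Prod>h'\<in>VH - {h}. 1 - eH h h' * xv g h')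
        | g h. g \<in> VG \<and> h \<in> VH}"

lemma vizing_gens_subset_carrier:
  assumes K: "subring K (ring_of_type_algebra :: real ring)"
    and "DG \<subseteq> VG" "DH \<subseteq> VH"
  shows "graph_gens eG VG DG kG \<union> graph_gens eH VH DH kH \<union> product_gens VG VH
    \<subseteq> carrier (vizing_ring K VG VH)"
proof -
  let ?P = "polys_over K (vizing_vars VG VH)"
  have eG: "eG g g' \<in> ?P" if "g \<in> VG" "g' \<in> VG" "g \<noteq> g'" for g g'
    using that by (intro polys_over_PVar[OF K]) (auto simp: vizing_vars_def nsets_def)
  have eH: "eH h h' \<in> ?P" if "h \<in> VH" "h' \<in> VH" "h \<noteq> h'" for h h'
    using that by (intro polys_over_PVar[OF K]) (auto simp: vizing_vars_def nsets_def)
  have xv: "xv g h \<in> ?P" if "g \<in> VG" "h \<in> VH" for g h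
    using that by (intro polys_over_PVar[OF K]) (auto simp: vizing_vars_def)
  have gens: "graph_gens e V D k \<subseteq> ?P"
    if e: "\<And>u v. u \<in> V \<Longrightarrow> v \<in> V \<Longrightarrow> u \<noteq> v \<Longrightarrow> e u v \<in> ?P" and "D \<subseteq> V"
    for e :: "'c \<Rightarrow> 'c \<Rightarrow> ('a, 'b) vvar rpoly" and V D k
    unfolding graph_gens_def using that(2)
    by (auto intro!: polys_over_diff[OF K] polys_over_power[OF K] polys_over_prod[OF K]
        polys_over_sum[OF K] polys_over_1[OF K] e)
  have "product_gens VG VH \<subseteq> ?P"
    unfolding product_gens_def
    by (auto intro!: polys_over_diff[OF K] polys_over_power[OF K] polys_over_prod[OF K]
        polys_over_mult[OF K] polys_over_1[OF K] eG eH xv)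
  moreover have "graph_gens eG VG DG kG \<subseteq> ?P" by (rule gens[OF eG assms(2)])
  moreover have "graph_gens eH VH DH kH \<subseteq> ?P" by (rule gens[OF eH assms(3)])
  ultimately show ?thesis by (simp add: mpoly_ring_def)
qed

definition I_sos ::
    "real set \<Rightarrow> 'a set \<Rightarrow> 'a set \<Rightarrow> nat \<Rightarrow> 'b set \<Rightarrow> 'b set \<Rightarrow> nat \<Rightarrow> ('a, 'b) vvar rpoly set" where
  "I_sos K VG DG kG VH DH kH =
     genideal (vizing_ring K VG VH)
       (graph_gens eG VG DG kG \<union> graph_gens eH VH DH kH \<union> product_gens VG VH)"

end

theory Submission
  imports Defs
begin

text \<open>
  Every variable of the Vizing ideal is idempotent modulo the ideal, so a polynomial lies in the
  ideal as soon as it vanishes at all Boolean zeros of the ideal. At such a zero both graphs have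
  exactly one edge: two different edges would provide two vertices that are both dominated by the
  remaining ones, contradicting minimality. Let \<open>uv\<close> be the edge of the first graph, and let
  \<open>t\<^sub>g\<close> be the number of selected vertices in row \<open>g\<close>. An isolated row has \<open>t\<^sub>g \<in> {2, 3}\<close>; it
  contributes \<open>- sqrt 2\<close> to \<open>s\<^sub>0\<close>, and its \<open>s\<^sub>g\<^sup>2\<close> equals \<open>t\<^sub>g - 2\<close>. What is left is an identity in
  the rows \<open>u\<close> and \<open>v\<close> alone, which is checked on the \<open>2\<^sup>6\<close> possible selections.
  The same pointwise identity, evaluated at a minimum dominating set of a product graph, bounds
  its size from below.
\<close>

section \<open>Evaluation of polynomials\<close>

definition monom_value :: "('v \<Rightarrow> real) \<Rightarrow> ('v \<Rightarrow>\<^sub>0 nat) \<Rightarrow> real" where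
  "monom_value a m = (\<Prod>v\<in>Poly_Mapping.keys m. a v ^ Poly_Mapping.lookup m v)"

text \<open>The evaluation homomorphism at the real point \<open>a\<close>.\<close>

definition insertion :: "('v \<Rightarrow> real) \<Rightarrow> 'v rpoly \<Rightarrow> real" where
  "insertion a p = (\<Sum>m\<in>Poly_Mapping.keys p. Poly_Mapping.lookup p m * monom_value a m)"

lemma monom_value_superset:
  assumes "finite V" "Poly_Mapping.keys m \<subseteq> V"
  shows "monom_value a m = (\<Prod>v\<in>V. a v ^ Poly_Mapping.lookup m v)"
  unfolding monom_value_def using assms by (intro prod.mono_neutral_left) (auto simp: in_keys_iff)

lemma monom_value_add: "monom_value a (m + n) = monom_value a m * monom_value a n"
proof -
  let ?V = "Poly_Mapping.keys m \<union> Poly_Mapping.keys n"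
  have "monom_value a l = (\<Prod>v\<in>?V. a v ^ Poly_Mapping.lookup l v)"
    if "Poly_Mapping.keys l \<subseteq> ?V" for l
    using that by (intro monom_value_superset) auto
  then show ?thesis
    using keys_add[of m n] by (simp add: lookup_add power_add prod.distrib)
qed

lemma insertion_single: "insertion a (Poly_Mapping.single m c) = c * monom_value a m"
  by (simp add: insertion_def)

lemma insertion_add: "insertion a (p + q) = insertion a p + insertion a q"
  unfolding insertion_def by (rule setsum_keys_plus_distrib) (simp_all add: distrib_right)

lemma insertion_uminus: "insertion a (- p) = - insertion a p"
  using insertion_add[of a p "- p"] by (simp add: insertion_def)

lemma insertion_diff: "insertion a (p - q) = insertion a p - insertion a q"
  using insertion_add[of a p "- q"] by (simp add: insertion_uminus)

lemma insertion_sum: "insertion a (sum p A) = (\<Sum>i\<in>A. insertion a (p i))"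
  by (induction A rule: infinite_finite_induct) (simp_all add: insertion_add, simp_all add: insertion_def)

lemma rpoly_expand:
  fixes p :: "'v rpoly"
  shows "p = (\<Sum>m\<in>Poly_Mapping.keys p. Poly_Mapping.single m (Poly_Mapping.lookup p m))"
  by (rule poly_mapping_eqI) (auto simp: lookup_sum lookup_single when_def in_keys_iff)

lemma insertion_mult: "insertion a (p * q) = insertion a p * insertion a q"
proof -
  have "insertion a (p * q) = insertion a
      (\<Sum>m\<in>Poly_Mapping.keys p. \<Sum>n\<in>Poly_Mapping.keys q.
        Poly_Mapping.single (m + n) (Poly_Mapping.lookup p m * Poly_Mapping.lookup q n))"
    by (subst rpoly_expand[of p], subst rpoly_expand[of q]) (simp add: sum_product mult_single)
  also have "\<dots> = insertion a p * insertion a q"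
    by (simp add: insertion_sum insertion_single monom_value_add) (simp add: sum_product insertion_def mult_ac)
  finally show ?thesis .
qed

lemma insertion_PConst: "insertion a (PConst c) = c"
  by (simp add: PConst_def insertion_single monom_value_def)

lemma PConst_of_nat: "PConst (real n) = of_nat n"
  by (simp add: PConst_def)

lemma PConst_numeral: "PConst (numeral w) = numeral w"
  by (simp add: PConst_def)

lemma PConst_1: "PConst 1 = 1"
  by (simp add: PConst_def)

lemma PConst_0: "PConst 0 = 0"
  by (simp add: PConst_def)

lemma PConst_mult: "PConst c * PConst d = PConst (c * d)"
  by (simp add: PConst_def mult_single)

lemma insertion_PVar: "insertion a (PVar v) = a v"
  by (simp add: PVar_def insertion_single monom_value_def)

lemma insertion_0: "insertion a 0 = 0"
  by (simp add: insertion_def)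

lemma insertion_1: "insertion a 1 = 1"
  by (metis insertion_PConst PConst_1)

lemma insertion_of_nat: "insertion a (of_nat n) = real n"
  by (metis insertion_PConst PConst_of_nat)

lemma insertion_numeral: "insertion a (numeral w) = numeral w"
  by (metis insertion_PConst PConst_numeral)

lemma insertion_prod: "insertion a (prod p A) = (\<Prod>i\<in>A. insertion a (p i))"
  by (induction A rule: infinite_finite_induct) (simp_all add: insertion_mult insertion_1)

lemma insertion_power: "insertion a (p ^ n) = insertion a p ^ n"
  by (induction n) (simp_all add: insertion_mult insertion_1)

lemmas insertion_simps = insertion_0 insertion_1 insertion_add insertion_diff insertion_mult
  insertion_sum insertion_prod insertion_power insertion_of_nat insertion_numeral
  insertion_PConst insertion_PVar

section \<open>Polynomials vanishing at Boolean points\<close>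

lemma monomial_eq_prod:
  "Poly_Mapping.single m 1 = (\<Prod>v\<in>Poly_Mapping.keys m. PVar v ^ Poly_Mapping.lookup m v :: 'v rpoly)"
proof -
  have PVar_power: "PVar v ^ n = (Poly_Mapping.single (Poly_Mapping.single v n) 1 :: 'v rpoly)" for v n
    by (induction n) (simp_all add: PVar_def mult_single flip: single_add)
  have prod_single: "(\<Prod>v\<in>V. Poly_Mapping.single (f v) 1) = (Poly_Mapping.single (\<Sum>v\<in>V. f v) 1 :: 'v rpoly)"
    if "finite V" for V :: "'v set" and f
    using that by induction (simp_all add: mult_single)
  have "m = (\<Sum>v\<in>Poly_Mapping.keys m. Poly_Mapping.single v (Poly_Mapping.lookup m v))"
    by (rule poly_mapping_eqI) (auto simp: lookup_sum lookup_single when_def in_keys_iff)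
  then show ?thesis
    by (simp add: PVar_power prod_single)
qed

text \<open>\<open>K[V]\<close> is generated as a ring by constants and variables: a polynomial is
  the sum of its terms, each a constant times powers of variables.\<close>

lemma polys_over_induct [consumes 2, case_names const var add mult]:
  fixes p :: "'v rpoly"
  assumes K: "subring K (ring_of_type_algebra :: real ring)"
    and p: "p \<in> polys_over K V"
    and const: "\<And>c. c \<in> K \<Longrightarrow> P (PConst c)"
    and var: "\<And>v. v \<in> V \<Longrightarrow> P (PVar v)"
    and add: "\<And>p q. P p \<Longrightarrow> P q \<Longrightarrow> P (p + q)"
    and mult: "\<And>p q. P p \<Longrightarrow> P q \<Longrightarrow> P (p * q)"
  shows "P p"
proof -
  \<comment> \<open>The constant 0 covers the empty sum and also the default value of a sum over an
    infinite set.\<close>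
  have sum: "P (\<Sum>i\<in>A. q i)" if "\<And>i. i \<in> A \<Longrightarrow> P (q i)" for A :: "'i set" and q
    using that const[of 0] by (induction A rule: infinite_finite_induct)
      (auto simp: PConst_0 real_subringD[OF K] add)
  have one: "P 1"
    using const[of 1] by (simp add: PConst_1 real_subringD[OF K])
  have prod: "P (\<Prod>i\<in>A. q i)" if "\<And>i. i \<in> A \<Longrightarrow> P (q i)" for A :: "'i set" and q
    using that one by (induction A rule: infinite_finite_induct) (auto simp: mult)
  have power: "P (q ^ n)" if "P q" for q n
    using that one by (induction n) (auto simp: mult)
  have "P (\<Sum>m\<in>Poly_Mapping.keys p. PConst (Poly_Mapping.lookup p m) *
      (\<Prod>v\<in>Poly_Mapping.keys m. PVar v ^ Poly_Mapping.lookup m v))"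
    using p by (intro sum mult const prod power var) (auto simp: polys_over_def)
  also have "(\<Sum>m\<in>Poly_Mapping.keys p. PConst (Poly_Mapping.lookup p m) *
      (\<Prod>v\<in>Poly_Mapping.keys m. PVar v ^ Poly_Mapping.lookup m v)) = p"
    by (subst (3) rpoly_expand) (simp add: PConst_def mult_single flip: monomial_eq_prod)
  finally show ?thesis .
qed

lemma polys_over_PConst: "c \<in> K \<Longrightarrow> PConst c \<in> polys_over K V"
  by (auto simp: PConst_def polys_over_def)

lemma mpoly_ring_simps:
  "carrier (mpoly_ring K V) = polys_over K V"
  "p \<otimes>\<^bsub>mpoly_ring K V\<^esub> q = p * q"
  "p \<oplus>\<^bsub>mpoly_ring K V\<^esub> q = p + q"
  "\<zero>\<^bsub>mpoly_ring K V\<^esub> = 0"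
  by (auto simp: mpoly_ring_def ring_of_type_algebra_def)

text \<open>Away from 0 this is uniqueness of inverses in a field; at 0 it is the convention
  \<open>inverse 0 = 0\<close>.\<close>

lemma real_subfield_inverse:
  assumes K: "subfield K (ring_of_type_algebra :: real ring)" and "c \<in> K"
  shows "inverse c \<in> K"
proof (cases "c = 0")
  case False
  interpret field "ring_of_type_algebra :: real ring" by (rule field_from_type_algebra)
  have "inv\<^bsub>ring_of_type_algebra\<^esub> c \<in> K - {\<zero>\<^bsub>ring_of_type_algebra\<^esub>}"
    using False assms by (intro subfield_m_inv(1)) (auto simp: ring_of_type_algebra_def)
  moreover have "inv\<^bsub>ring_of_type_algebra\<^esub> c = inverse c"
    using False by (intro comm_inv_char) (auto simp: ring_of_type_algebra_def)
  ultimately show ?thesis by simp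
qed (use assms in simp)

text \<open>\<open>p\<close> is the sum of the products \<open>p * \<delta> A\<close> over all
  Boolean points \<open>A\<close>. At a common zero \<open>A\<close> of \<open>I\<close>,
  \<open>p * \<delta> A\<close> is congruent to the value of \<open>p\<close> at \<open>A\<close>,
  which is 0, times \<open>\<delta> A\<close>. At any other point some member of \<open>I\<close>
  has a nonzero value, and dividing by it puts \<open>\<delta> A\<close> itself into
  \<open>I\<close>.\<close>

lemma boolean_nullstellensatz:
  fixes p :: "'v rpoly"
  assumes K: "subfield K (ring_of_type_algebra :: real ring)" and V: "finite V"
    and I: "ideal I (mpoly_ring K V)"
    and bool: "\<And>v. v \<in> V \<Longrightarrow> (PVar v)\<^sup>2 - PVar v \<in> I"
    and p: "p \<in> polys_over K V"
    and vanish: "\<And>A. A \<subseteq> V \<Longrightarrow> (\<And>q. q \<in> I \<Longrightarrow> insertion (\<lambda>v. of_bool (v \<in> A)) q = 0) \<Longrightarrow>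
       insertion (\<lambda>v. of_bool (v \<in> A)) p = 0"
  shows "p \<in> I"
proof -
  let ?P = "polys_over K V"
  interpret ideal I "mpoly_ring K V" by fact
  have KR: "subring K (ring_of_type_algebra :: real ring)"
    using subfieldE(1)[OF K] .
  have IP: "q \<in> ?P" if "q \<in> I" for q
    using a_subset that by (auto simp: mpoly_ring_simps)
  have Iadd: "q + r \<in> I" if "q \<in> I" "r \<in> I" for q r
    using additive_subgroup.a_closed[OF is_additive_subgroup that] by (simp add: mpoly_ring_simps)
  have Imult: "r * q \<in> I" if "q \<in> I" "r \<in> ?P" for q r
    using I_l_closed[OF that(1), of r] that by (simp add: mpoly_ring_simps)
  have I0: "0 \<in> I"
    using additive_subgroup.zero_closed[OF is_additive_subgroup] by (simp add: mpoly_ring_simps)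
  have Isum: "sum q A \<in> I" if "\<And>i. i \<in> A \<Longrightarrow> q i \<in> I" for q :: "'v set \<Rightarrow> _" and A
    using that by (induction A rule: infinite_finite_induct) (auto intro: I0 Iadd)
  define \<delta> :: "'v set \<Rightarrow> 'v rpoly" where "\<delta> A = (\<Prod>v\<in>A. PVar v) * (\<Prod>v\<in>V - A. 1 - PVar v)" for A
  \<comment> \<open>Modulo \<open>I\<close>, \<open>\<delta> A\<close> is the indicator function of the Boolean point \<open>A\<close>; these sum to \<open>1\<close>.\<close>
  have "p * \<delta> A \<in> I" if A: "A \<subseteq> V" for A
  proof -
    let ?a = "\<lambda>v. of_bool (v \<in> A) :: real"
    have \<delta>P: "\<delta> A \<in> ?P"
      unfolding \<delta>_def using A
      by (intro polys_over_mult[OF KR] polys_over_prod[OF KR] polys_over_diff[OF KR]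
          polys_over_1[OF KR] polys_over_PVar[OF KR]) auto
    \<comment> \<open>Modulo \<open>I\<close>, multiplication by \<open>\<delta> A\<close> replaces
      \<open>q\<close> by its value at \<open>A\<close>. The memberships in \<open>K\<close> and
      \<open>?P\<close> are carried along because \<open>I\<close> absorbs factors from
      \<open>?P\<close>.\<close>
    have val: "insertion ?a q \<in> K \<and> q \<in> ?P \<and> (q - PConst (insertion ?a q)) * \<delta> A \<in> I"
      if "q \<in> ?P" for q
      using KR that
    proof (induction rule: polys_over_induct)
      case (const c)
      then show ?case by (simp add: insertion_simps polys_over_PConst I0)
    next
      case (var v)
      have sq: "(PVar v)\<^sup>2 - PVar v \<in> I" using var by (rule bool)
      have "(PVar v - PConst (?a v)) * \<delta> A \<in> I"
      proof (cases "v \<in> A")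
        case True
        \<comment> \<open>The variable \<open>v\<close> is a factor of \<open>\<delta> A\<close>,
          and (v - 1) v lies in \<open>I\<close>.\<close>
        let ?r = "(\<Prod>u\<in>A - {v}. PVar u) * (\<Prod>u\<in>V - A. 1 - PVar u) :: 'v rpoly"
        have "\<delta> A = PVar v * ?r"
          using True finite_subset[OF A V] by (simp add: \<delta>_def prod.remove mult_ac)
        then have "(PVar v - PConst (?a v)) * \<delta> A = ?r * ((PVar v)\<^sup>2 - PVar v)"
          using True by (simp add: PConst_1 algebra_simps power2_eq_square)
        moreover have "?r \<in> ?P"
          using A by (intro polys_over_mult[OF KR] polys_over_prod[OF KR] polys_over_diff[OF KR]
              polys_over_1[OF KR] polys_over_PVar[OF KR]) auto
        ultimately show ?thesis using Imult[OF sq] by simp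
      next
        case False
        \<comment> \<open>Here 1 - v is a factor of \<open>\<delta> A\<close>, and v (1 - v) is
          minus the Boolean element of \<open>I\<close>.\<close>
        let ?r = "(\<Prod>u\<in>A. PVar u) * (\<Prod>u\<in>V - A - {v}. 1 - PVar u) :: 'v rpoly"
        have "(\<Prod>u\<in>V - A. 1 - PVar u) = (1 - PVar v) * (\<Prod>u\<in>V - A - {v}. 1 - PVar u :: 'v rpoly)"
          using False V var by (intro prod.remove) auto
        then have "\<delta> A = (1 - PVar v) * ?r"
          by (simp add: \<delta>_def mult_ac)
        then have "(PVar v - PConst (?a v)) * \<delta> A = (- ?r) * ((PVar v)\<^sup>2 - PVar v)"
          using False by (simp only: of_bool_def if_False PConst_0) (simp add: algebra_simps power2_eq_square)
        moreover have "- ?r \<in> ?P"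
          using A by (intro polys_over_uminus[OF KR] polys_over_mult[OF KR] polys_over_prod[OF KR]
              polys_over_diff[OF KR] polys_over_1[OF KR] polys_over_PVar[OF KR]) auto
        ultimately show ?thesis using Imult[OF sq] by metis
      qed
      then show ?case
        using var by (simp add: insertion_simps real_subringD[OF KR] polys_over_PVar[OF KR])
    next
      case (add q r)
      have "(q + r - PConst (insertion ?a (q + r))) * \<delta> A =
          (q - PConst (insertion ?a q)) * \<delta> A + (r - PConst (insertion ?a r)) * \<delta> A"
        by (simp add: insertion_add PConst_def single_add algebra_simps)
      then show ?case
        using add Iadd by (auto simp: insertion_add real_subringD[OF KR] polys_over_add[OF KR])
    next
      case (mult q r)
      have "(q * r - PConst (insertion ?a (q * r))) * \<delta> A =
          q * ((r - PConst (insertion ?a r)) * \<delta> A) +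
          PConst (insertion ?a r) * ((q - PConst (insertion ?a q)) * \<delta> A)"
        by (simp add: insertion_mult algebra_simps flip: PConst_mult)
      then show ?case
        using mult by (auto intro!: Iadd Imult polys_over_PConst
            simp: insertion_mult real_subringD[OF KR] polys_over_mult[OF KR])
    qed
    show ?thesis
    proof (cases "\<forall>q\<in>I. insertion ?a q = 0")
      case True
      then have "insertion ?a p = 0" using vanish[OF A] by blast
      then show ?thesis using val[OF p] by (simp add: PConst_0)
    next
      case False
      then obtain q where q: "q \<in> I" "insertion ?a q \<noteq> 0" by blast
      define c where "c = insertion ?a q"
      have c: "c \<in> K" "(q - PConst c) * \<delta> A \<in> I"
        using val[OF IP[OF q(1)]] by (simp_all add: c_def)
      have "- 1 / c \<in> K" "1 / c \<in> K"
        using real_subfield_inverse[OF K c(1)] by (simp_all add: real_subringD[OF KR] field_simps)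
      \<comment> \<open>This combination of two members of \<open>I\<close> collapses to
        \<open>\<delta> A\<close>.\<close>
      then have "PConst (1 / c) * (\<delta> A * q) + PConst (- 1 / c) * ((q - PConst c) * \<delta> A) \<in> I"
        by (intro Iadd[OF Imult[OF Imult[OF q(1) \<delta>P]] Imult[OF c(2)]] polys_over_PConst)
      also have "PConst (1 / c) * (\<delta> A * q) + PConst (- 1 / c) * ((q - PConst c) * \<delta> A)
          = (PConst (1 / c) + PConst (- 1 / c)) * q * \<delta> A - PConst (- 1 / c) * PConst c * \<delta> A"
        by (simp add: algebra_simps)
      also have "PConst (1 / c) + PConst (- 1 / c) = (0 :: 'v rpoly)"
        by (simp add: PConst_def flip: single_add)
      also have "PConst (- 1 / c) * PConst c = (- 1 :: 'v rpoly)"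
        using q(2) by (simp add: PConst_mult c_def) (simp add: PConst_def flip: single_one single_uminus)
      finally show ?thesis using Imult[OF _ p] by simp
    qed
  qed
  then have "(\<Sum>A\<in>Pow V. p * \<delta> A) \<in> I" by (intro Isum) auto
  moreover have "(\<Sum>A\<in>Pow V. \<delta> A) = (\<Prod>v\<in>V. PVar v + (1 - PVar v))"
    unfolding \<delta>_def by (rule prod_add[OF V, symmetric])
  ultimately show ?thesis by (simp flip: sum_distrib_left)
qed


section \<open>Total degree\<close>

lemma total_degree_le_iff:
  "total_degree p \<le> l \<longleftrightarrow>
     (\<forall>m\<in>Poly_Mapping.keys p. (\<Sum>v\<in>Poly_Mapping.keys m. Poly_Mapping.lookup m v) \<le> l)"
  by (simp add: total_degree_def)

lemma total_degree_PConst: "total_degree (PConst c) \<le> l"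
  by (auto simp: total_degree_le_iff PConst_def)

lemma total_degree_PVar: "1 \<le> l \<Longrightarrow> total_degree (PVar v) \<le> l"
  by (simp add: total_degree_le_iff PVar_def)

lemma total_degree_add: "total_degree p \<le> l \<Longrightarrow> total_degree q \<le> l \<Longrightarrow> total_degree (p + q) \<le> l"
  using keys_add[of p q] unfolding total_degree_le_iff by blast

lemma total_degree_diff: "total_degree p \<le> l \<Longrightarrow> total_degree q \<le> l \<Longrightarrow> total_degree (p - q) \<le> l"
  using keys_diff[of p q] unfolding total_degree_le_iff by blast

lemma total_degree_sum:
  "(\<And>i. i \<in> A \<Longrightarrow> total_degree (p i) \<le> l) \<Longrightarrow> total_degree (sum p A) \<le> l"
  using keys_sum[of p A] unfolding total_degree_le_iff by blast

lemma total_degree_mult: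
  assumes "total_degree p \<le> k" "total_degree q \<le> l"
  shows "total_degree (p * q) \<le> k + l"
  unfolding total_degree_le_iff
proof
  fix m assume "m \<in> Poly_Mapping.keys (p * q)"
  then obtain a b where ab: "a \<in> Poly_Mapping.keys p" "b \<in> Poly_Mapping.keys q" "m = a + b"
    using keys_mult[of p q] by blast
  have "(\<Sum>v\<in>Poly_Mapping.keys m. Poly_Mapping.lookup m v) =
      (\<Sum>v\<in>Poly_Mapping.keys a. Poly_Mapping.lookup a v) + (\<Sum>v\<in>Poly_Mapping.keys b. Poly_Mapping.lookup b v)"
    unfolding ab(3) by (rule setsum_keys_plus_distrib) auto
  then show "(\<Sum>v\<in>Poly_Mapping.keys m. Poly_Mapping.lookup m v) \<le> k + l"
    using ab assms unfolding total_degree_le_iff by (metis add_mono)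
qed

section \<open>Graphs on \<open>n\<close> vertices with domination number \<open>n - 1\<close>\<close>

text \<open>What the vanishing of \<open>graph_gens\<close> says at a Boolean point:
  \<open>D\<close> dominates, and no set of size \<open>k - 1\<close> does. \<open>E\<close> may
  contain sets that are not pairs from \<open>V\<close>; only pairs of distinct vertices are ever
  tested.\<close>

definition dominated_edges :: "'c set \<Rightarrow> 'c set \<Rightarrow> nat \<Rightarrow> 'c set set \<Rightarrow> bool" where
  "dominated_edges V D k E \<longleftrightarrow>
     (\<forall>g\<in>V - D. \<exists>g'\<in>D. {g, g'} \<in> E) \<and>
     (\<forall>S. S \<subseteq> V \<and> card S = k - 1 \<longrightarrow> (\<exists>g'\<in>V - S. \<forall>g\<in>S. {g, g'} \<notin> E))"

text \<open>The single vertex \<open>d\<close> outside \<open>D\<close> has a neighbour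
  \<open>u\<close>. Any second edge would yield two vertices that the other \<open>k - 1\<close>
  vertices dominate.\<close>

lemma dominated_edges_unique:
  assumes V: "finite V" "D \<subseteq> V" and card: "card D = k" "card V = Suc k" "k > 0"
    and E: "dominated_edges V D k E"
  obtains u v where "u \<in> V" "v \<in> V" "u \<noteq> v"
    "\<forall>g\<in>V. \<forall>g'\<in>V. g \<noteq> g' \<longrightarrow> ({g, g'} \<in> E \<longleftrightarrow> {g, g'} = {u, v})"
proof -
  have "card (V - D) = 1"
    using V card by (simp add: card_Diff_subset finite_subset)
  then obtain d where d: "V - D = {d}" by (rule card_1_singletonE)
  then obtain u where u: "u \<in> D" "{d, u} \<in> E"
    using E unfolding dominated_edges_def by blast
  have du: "d \<in> V" "u \<in> V" "d \<noteq> u" using d u V by auto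
  \<comment> \<open>If \<open>y\<close> and \<open>z\<close> both have neighbours outside
    \<open>{y, z}\<close>, the complement of \<open>{y, z}\<close> dominates; its size is
    \<open>Suc k - 2 = k - 1\<close>.\<close>
  have crossing: False if "y \<in> V" "z \<in> V" "y \<noteq> z" "y' \<in> V - {y, z}" "z' \<in> V - {y, z}"
    "{y', y} \<in> E" "{z', z} \<in> E" for y z y' z'
  proof -
    have "card (V - {y, z}) = k - 1"
      using that V card by (simp add: card_Diff_subset)
    then obtain w where "w \<in> V - (V - {y, z})" "\<forall>g\<in>V - {y, z}. {g, w} \<notin> E"
      using E unfolding dominated_edges_def by (metis Diff_subset)
    then show False using that by blast
  qed
  have "{p, q} = {d, u}" if pq: "p \<in> V" "q \<in> V" "p \<noteq> q" "{p, q} \<in> E" for p q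
  proof (rule ccontr)
    assume ne: "{p, q} \<noteq> {d, u}"
    have E': "{q, p} \<in> E" "{u, d} \<in> E" using pq u by (simp_all add: insert_commute)
    \<comment> \<open>If the second edge shares a vertex with \<open>{d, u}\<close>, the two outer
      ends are removed, both being adjacent to the shared vertex. If it is disjoint from
      \<open>{d, u}\<close>, one end of each edge is removed.\<close>
    consider "p = d" "q \<noteq> u" | "p = u" "q \<noteq> d" | "q = d" "p \<noteq> u" | "q = u" "p \<noteq> d"
      | "p \<noteq> d" "p \<noteq> u" "q \<noteq> d" "q \<noteq> u"
      using ne by (auto simp: doubleton_eq_iff)
    then show False
    proof cases
      case 1
      then show ?thesis using crossing[of q u d d] du pq u E' by auto
    next
      case 2
      then show ?thesis using crossing[of q d u u] du pq u E' by auto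
    next
      case 3
      then show ?thesis using crossing[of p u d d] du pq u E' by auto
    next
      case 4
      then show ?thesis using crossing[of p d u u] du pq u E' by auto
    next
      case 5
      then show ?thesis using crossing[of p d q u] du pq u E' by auto
    qed
  qed
  moreover have "{p, q} \<in> E" if "{p, q} = {d, u}" for p q
    using that u by simp
  ultimately show thesis using that[OF du] by blast
qed

section \<open>Minimum dominating sets of a graph\<close>

lemma domination_number_witness:
  assumes "finite (pverts G)"
  obtains D where "dominating G D" "card D = domination_number G"
proof -
  have fin: "finite {D. dominating G D}"
    by (rule finite_subset[of _ "Pow (pverts G)"]) (use assms in \<open>auto simp: dominating_def\<close>)
  have "dominating G (pverts G)" by (simp add: dominating_def)
  then have "domination_number G \<in> card ` {D. dominating G D}"
    unfolding domination_number_def using fin by (intro Min_in) auto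
  then show thesis using that by auto
qed

lemma domination_number_le:
  assumes "finite (pverts G)" "dominating G D"
  shows "domination_number G \<le> card D"
proof -
  have "finite {D. dominating G D}"
    by (rule finite_subset[of _ "Pow (pverts G)"]) (use assms in \<open>auto simp: dominating_def\<close>)
  then show ?thesis
    unfolding domination_number_def using assms by (intro Min_le) auto
qed

text \<open>Links actual graphs to the edge sets read off from Boolean points; \<open>D\<close> is a
  minimum dominating set.\<close>

lemma dominated_edges_graph:
  assumes G: "pair_graph G" and k: "domination_number G = k" "k > 0"
  obtains D where "D \<subseteq> pverts G" "card D = k"
    "dominated_edges (pverts G) D k {{g, g'} | g g'. (g, g') \<in> parcs G}"
proof -
  interpret pair_graph G by fact
  have sym: "(v, u) \<in> parcs G" if "(u, v) \<in> parcs G" for u v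
    using pair_sym_arcs that by (auto simp: symmetric_def sym_def)
  have E: "{g, g'} \<in> {{g, g'} | g g'. (g, g') \<in> parcs G} \<longleftrightarrow> (g', g) \<in> parcs G" for g g'
    using sym by (auto simp: doubleton_eq_iff)
  obtain D where D: "dominating G D" "card D = k"
    using domination_number_witness[OF pair_finite_verts] k(1) by metis
  \<comment> \<open>Positivity of \<open>k\<close> makes \<open>k - 1\<close> strictly smaller than
    the domination number.\<close>
  have "\<not> dominating G S" if "card S = k - 1" for S
    using domination_number_le[OF pair_finite_verts, of S] that k by auto
  then have "dominated_edges (pverts G) D k {{g, g'} | g g'. (g, g') \<in> parcs G}"
    unfolding dominated_edges_def E using D sym unfolding dominating_def by blast
  then show thesis using D that by (auto simp: dominating_def)
qed

section \<open>The certificate at Boolean points\<close>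

text \<open>The row has t = 2, q = 1 or t = 3, q = 3; the coefficients -2/3 and 1/3 are such that
  both cases give -1.\<close>

lemma certificate_isolated_row:
  fixes a b c :: bool
  assumes c "a \<or> b"
  defines "t \<equiv> of_bool a + of_bool b + of_bool c :: real"
    and "q \<equiv> of_bool a * of_bool b + of_bool a * of_bool c + of_bool b * of_bool c :: real"
  shows "- (2 / 3) * t + 1 / 3 * q = - 1" "(1 / 3 * (t - 2 * q))\<^sup>2 = t - 2"
  using assms by (auto simp: t_def q_def power2_eq_square)

text \<open>Unprimed and primed letters are the rows of the two ends of the edge of the first graph,
  and \<open>{a, b}\<close> is the edge of the second. The assumptions are the domination conditions
  on these six vertices. The factor 2 is the square of \<open>sqrt 2\<close>.\<close>

lemma certificate_edge_rows:
  fixes a b c a' b' c' :: bool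
  assumes "c \<or> c'" "a \<or> b \<or> a'" "a \<or> b \<or> b'" "a' \<or> b' \<or> a" "a' \<or> b' \<or> b"
  defines "t \<equiv> of_bool a + of_bool b + of_bool c :: real"
    and "q \<equiv> of_bool a * of_bool b + of_bool a * of_bool c + of_bool b * of_bool c :: real"
    and "t' \<equiv> of_bool a' + of_bool b' + of_bool c' :: real"
    and "q' \<equiv> of_bool a' * of_bool b' + of_bool a' * of_bool c' + of_bool b' * of_bool c' :: real"
  shows "t + t' - 2 = 2 * (1 + (- (2 / 3) * t + 1 / 3 * q) + (- (2 / 3) * t' + 1 / 3 * q'))\<^sup>2 +
    (1 / 3 * (t - 2 * q))\<^sup>2 + (1 / 3 * (t' - 2 * q'))\<^sup>2"
  using assms(1-5) unfolding t_def q_def t'_def q'_def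
  by (cases a; cases b; cases c; cases a'; cases b'; cases c') (simp_all add: power2_eq_square)

text \<open>Edge sets and selection are kept abstract so that the identity applies both to Boolean
  zeros of the ideal and to dominating sets of a product graph.\<close>

lemma certificate_at_point:
  fixes sel :: "'a \<Rightarrow> 'b \<Rightarrow> bool" and x :: "'a \<Rightarrow> 'b \<Rightarrow> real"
  assumes x_def: "\<And>g h. x g h = of_bool (sel g h)"
    and VG: "finite VG" "DG \<subseteq> VG" "card DG = k" "card VG = Suc k" "k > 0" "dominated_edges VG DG k E"
    and VH: "DH \<subseteq> VH" "card DH = 2" "card VH = 3" "dominated_edges VH DH 2 F"
    and dom: "\<And>g h. g \<in> VG \<Longrightarrow> h \<in> VH \<Longrightarrow> sel g h \<or>
      (\<exists>g'\<in>VG - {g}. {g, g'} \<in> E \<and> sel g' h) \<or> (\<exists>h'\<in>VH - {h}. {h, h'} \<in> F \<and> sel g h')"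
  shows "(\<Sum>g\<in>VG. \<Sum>h\<in>VH. x g h) - real (k * 2) =
    (sqrt 2 * k + - (2 / 3) * sqrt 2 * (\<Sum>g\<in>VG. \<Sum>h\<in>VH. x g h)
      + (1 / 3) * sqrt 2 * (\<Sum>g\<in>VG. \<Sum>p\<in>nsets VH 2. \<Prod>h\<in>p. x g h))\<^sup>2
    + (\<Sum>g\<in>VG. (1 / 3 * ((\<Sum>h\<in>VH. x g h) - 2 * (\<Sum>p\<in>nsets VH 2. \<Prod>h\<in>p. x g h)))\<^sup>2)"
proof -
  obtain u v where uv: "u \<in> VG" "v \<in> VG" "u \<noteq> v"
    and E: "\<forall>g\<in>VG. \<forall>g'\<in>VG. g \<noteq> g' \<longrightarrow> ({g, g'} \<in> E \<longleftrightarrow> {g, g'} = {u, v})"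
    by (rule dominated_edges_unique[OF VG(1-6)])
  have finH: "finite VH" using VH(3) card.infinite by fastforce
  \<comment> \<open>The second graph also has domination number one below its order, so it too has
    exactly one edge.\<close>
  have cardH: "card VH = Suc 2" using VH(3) by simp
  obtain a b where ab: "a \<in> VH" "b \<in> VH" "a \<noteq> b"
    and F: "\<forall>h\<in>VH. \<forall>h'\<in>VH. h \<noteq> h' \<longrightarrow> ({h, h'} \<in> F \<longleftrightarrow> {h, h'} = {a, b})"
    by (rule dominated_edges_unique[OF finH VH(1,2) cardH _ VH(4)]) auto
  have "card (VH - {a, b}) = 1"
    using ab finH VH(3) by (simp add: card_Diff_subset)
  then obtain c where "VH - {a, b} = {c}" by (rule card_1_singletonE)
  then have abc: "VH = {a, b, c}" "a \<noteq> c" "b \<noteq> c" using ab by auto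
  have dom': "sel g h \<or> (\<exists>g'\<in>VG - {g}. {g, g'} = {u, v} \<and> sel g' h) \<or> (\<exists>h'\<in>VH - {h}. {h, h'} = {a, b} \<and> sel g h')"
    if "g \<in> VG" "h \<in> VH" for g h
    using dom[OF that] E F that by (metis DiffD1 DiffD2 insertI1)
  define t where "t g = x g a + x g b + x g c" for g
  define q where "q g = x g a * x g b + x g a * x g c + x g b * x g c" for g
  \<comment> \<open>\<open>\<phi> g\<close> is the contribution of row \<open>g\<close> to
    \<open>s0\<close>, divided by \<open>sqrt 2\<close>; \<open>r g\<close> is the square of
    \<open>s g\<close>.\<close>
  define \<phi> where "\<phi> g = - (2 / 3) * t g + 1 / 3 * q g" for g
  define r where "r g = (1 / 3 * (t g - 2 * q g))\<^sup>2" for g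
  have t: "(\<Sum>h\<in>VH. x g h) = t g" for g
    using ab abc by (simp add: t_def)
  have "nsets VH 2 = {{a, b}, {a, c}, {b, c}}"
    using ab abc by (auto simp: nsets_2_eq)
  then have q: "(\<Sum>p\<in>nsets VH 2. \<Prod>h\<in>p. x g h) = q g" for g
    using ab(3) abc(2,3) by (simp add: q_def doubleton_eq_iff)
  let ?W = "VG - {u, v}"
  have split: "sum f VG = f u + f v + sum f ?W" for f :: "'a \<Rightarrow> real"
    using uv VG(1) by (simp add: sum.remove[of VG u] sum.remove[of "VG - {u}" v] Diff_insert2[symmetric]
        insert_commute flip: Diff_insert)
  \<comment> \<open>The vertex (g, c) is isolated in the product and must be selected; (g, a) has
    (g, b) as its only neighbour.\<close>
  have iso: "\<phi> g = - 1 \<and> r g = t g - 2" if "g \<in> ?W" for g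
  proof -
    have "sel g c" "sel g a \<or> sel g b"
      using dom'[of g c] dom'[of g a] that ab abc by (auto simp: doubleton_eq_iff)
    then show ?thesis
      using certificate_isolated_row[of "sel g c" "sel g a" "sel g b"]
      by (simp add: \<phi>_def r_def t_def q_def x_def)
  qed
  have "sel u c \<or> sel v c" "sel u a \<or> sel u b \<or> sel v a" "sel u a \<or> sel u b \<or> sel v b"
    "sel v a \<or> sel v b \<or> sel u a" "sel v a \<or> sel v b \<or> sel u b"
    using dom'[of u c] dom'[of u a] dom'[of u b] dom'[of v a] dom'[of v b] uv ab abc
    by (auto simp: doubleton_eq_iff)
  then have edge: "t u + t v - 2 = 2 * (1 + \<phi> u + \<phi> v)\<^sup>2 + r u + r v"
    using certificate_edge_rows[of "sel u c" "sel v c" "sel u a" "sel u b" "sel v a" "sel v b"]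
    by (simp add: \<phi>_def r_def t_def q_def x_def)
  have cardW: "real (card ?W) = real k - 1"
    using uv VG(1,4,5) by (simp add: card_Diff_subset of_nat_diff)
  have sum_\<phi>: "sum \<phi> VG = \<phi> u + \<phi> v - (real k - 1)"
    unfolding split[of \<phi>] using iso cardW by simp
  have sum_r: "sum r VG = r u + r v + (sum t ?W - 2 * (real k - 1))"
    unfolding split[of r] using iso cardW by (simp add: sum_subtractf)
  have \<phi>_eq: "sum \<phi> VG = - (2 / 3) * sum t VG + 1 / 3 * sum q VG"
    unfolding \<phi>_def sum.distrib sum_distrib_left ..
  \<comment> \<open>The \<open>k - 1\<close> isolated rows each subtract 1 from \<open>k\<close>,
    which leaves the 1 of \<open>certificate_edge_rows\<close>.\<close>
  have "sqrt 2 * k + - (2 / 3) * sqrt 2 * sum t VG + (1 / 3) * sqrt 2 * sum q VG = sqrt 2 * (k + sum \<phi> VG)"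
    unfolding \<phi>_eq by (simp add: algebra_simps)
  also have "(\<dots>)\<^sup>2 = 2 * (1 + \<phi> u + \<phi> v)\<^sup>2"
    unfolding sum_\<phi> power_mult_distrib by (simp add: add_ac)
  finally have "(sqrt 2 * k + - (2 / 3) * sqrt 2 * sum t VG + (1 / 3) * sqrt 2 * sum q VG)\<^sup>2 =
    2 * (1 + \<phi> u + \<phi> v)\<^sup>2" .
  moreover have "sum t VG - real (k * 2) = 2 * (1 + \<phi> u + \<phi> v)\<^sup>2 + sum r VG"
    using edge sum_r split[of t] by simp
  moreover have "(\<Sum>g\<in>VG. (1 / 3 * (t g - 2 * q g))\<^sup>2) = sum r VG"
    by (simp add: r_def)
  ultimately show ?thesis
    unfolding t q by (simp only:)
qed

section \<open>The Vizing ideal and its Boolean zeros\<close>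

text \<open>A vanishing product has a zero factor, and a vanishing sum of 0/1 values has only zero
  terms. The map \<open>c\<close> will be \<open>EG\<close> or \<open>EH\<close>.\<close>

lemma dominated_edges_if_vanish:
  fixes A :: "'v set"
  assumes fin: "finite V" "D \<subseteq> V"
    and vanish: "\<And>p. p \<in> graph_gens (\<lambda>g g'. PVar (c {g, g'})) V D k \<Longrightarrow>
      insertion (\<lambda>v. of_bool (v \<in> A)) p = 0"
  shows "dominated_edges V D k {e. c e \<in> A}"
  unfolding dominated_edges_def
proof (intro conjI ballI allI impI)
  fix g assume "g \<in> V - D"
  then have "insertion (\<lambda>v. of_bool (v \<in> A)) (\<Prod>g'\<in>D. 1 - PVar (c {g, g'})) = 0"
    by (intro vanish) (auto simp: graph_gens_def)
  moreover have "finite D" using fin by (rule finite_subset[rotated])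
  ultimately show "\<exists>g'\<in>D. {g, g'} \<in> {e. c e \<in> A}"
    by (auto simp: insertion_simps)
next
  fix S assume S: "S \<subseteq> V \<and> card S = k - 1"
  then have "insertion (\<lambda>v. of_bool (v \<in> A)) (\<Prod>g'\<in>V - S. \<Sum>g\<in>S. PVar (c {g, g'})) = 0"
    by (intro vanish) (auto simp: graph_gens_def)
  then obtain g' where g': "g' \<in> V - S" "(\<Sum>g\<in>S. of_bool (c {g, g'} \<in> A) :: real) = 0"
    using fin by (auto simp: insertion_simps)
  moreover have "finite S" using S fin finite_subset by blast
  ultimately have "\<forall>g\<in>S. c {g, g'} \<notin> A"
    by (subst (asm) sum_nonneg_eq_0_iff) auto
  then show "\<exists>g'\<in>V - S. \<forall>g\<in>S. {g, g'} \<notin> {e. c e \<in> A}"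
    using g' by blast
qed

text \<open>The three factors of the generator vanish in the three ways of dominating (g, h): by
  itself, from its column, or from its row.\<close>

lemma product_gens_vanish:
  assumes fin: "finite VG" "finite VH"
    and vanish: "\<And>p. p \<in> product_gens VG VH \<Longrightarrow> insertion (\<lambda>v. of_bool (v \<in> A)) p = 0"
    and gh: "g \<in> VG" "h \<in> VH"
  shows "XV g h \<in> A \<or> (\<exists>g'\<in>VG - {g}. {g, g'} \<in> {e. EG e \<in> A} \<and> XV g' h \<in> A) \<or>
    (\<exists>h'\<in>VH - {h}. {h, h'} \<in> {e. EH e \<in> A} \<and> XV g h' \<in> A)"
proof -
  have "insertion (\<lambda>v. of_bool (v \<in> A)) ((1 - xv g h) * (\<Prod>g'\<in>VG - {g}. 1 - eG g g' * xv g' h)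
      * (\<Prod>h'\<in>VH - {h}. 1 - eH h h' * xv g h')) = 0"
    using gh by (intro vanish) (auto simp: product_gens_def)
  then show ?thesis
    using fin by (auto simp: insertion_simps simp flip: of_bool_conj)
qed

lemma finite_vizing_vars:
  assumes "finite VG" "finite VH"
  shows "finite (vizing_vars VG VH)"
proof -
  have "{XV g h | g h. g \<in> VG \<and> h \<in> VH} = (\<lambda>(g, h). XV g h) ` (VG \<times> VH)" by auto
  then show ?thesis
    using assms by (simp add: vizing_vars_def finite_imp_finite_nsets)
qed

text \<open>Provides the idempotency hypothesis of \<open>boolean_nullstellensatz\<close>.\<close>

lemma vizing_gens_boolean:
  assumes "v \<in> vizing_vars VG VH"
  shows "(PVar v)\<^sup>2 - PVar v \<in>
    graph_gens eG VG DG kG \<union> graph_gens eH VH DH kH \<union> product_gens VG VH"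
proof -
  consider e where "v = EG e" "e \<in> nsets VG 2" | e where "v = EH e" "e \<in> nsets VH 2"
    | g h where "v = XV g h" "g \<in> VG" "h \<in> VH"
    using assms by (auto simp: vizing_vars_def)
  then show ?thesis
  proof cases
    case 1
    then obtain g g' where "e = {g, g'}" "g \<in> VG" "g' \<in> VG" "g \<noteq> g'" by (auto elim: nsets2_E)
    then show ?thesis unfolding 1 graph_gens_def by blast
  next
    case 2
    then obtain h h' where "e = {h, h'}" "h \<in> VH" "h' \<in> VH" "h \<noteq> h'" by (auto elim: nsets2_E)
    then show ?thesis unfolding 2 graph_gens_def by blast
  next
    case 3
    then show ?thesis unfolding product_gens_def by blast
  qed
qed

lemma I_sos_ideal:
  assumes "subring K (ring_of_type_algebra :: real ring)" "DG \<subseteq> VG" "DH \<subseteq> VH"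
  shows "ideal (I_sos K VG DG kG VH DH kH) (vizing_ring K VG VH)"
    and "graph_gens eG VG DG kG \<union> graph_gens eH VH DH kH \<union> product_gens VG VH
      \<subseteq> I_sos K VG DG kG VH DH kH"
proof -
  interpret cring "vizing_ring K VG VH" by (rule cring_mpoly_ring[OF assms(1)])
  show "ideal (I_sos K VG DG kG VH DH kH) (vizing_ring K VG VH)"
    "graph_gens eG VG DG kG \<union> graph_gens eH VH DH kH \<union> product_gens VG VH
      \<subseteq> I_sos K VG DG kG VH DH kH"
    unfolding I_sos_def
    using vizing_gens_subset_carrier[OF assms] by (rule genideal_ideal, rule genideal_self)
qed

lemma real_of_nat_in_subring:
  assumes "subring K (ring_of_type_algebra :: real ring)"
  shows "real n \<in> K"
  by (induction n) (auto simp: real_subringD[OF assms])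

text \<open>At the indicator of a minimum dominating set \<open>T\<close> of the product, the left
  side of the pointwise identity is \<open>card T - 2 * k\<close> and the right side is a sum of
  squares.\<close>

lemma vizing_inequality:
  assumes G: "pair_graph G" "card (pverts G) = Suc k" "domination_number G = k" "k > 0"
    and H: "pair_graph H" "card (pverts H) = 3" "domination_number H = 2"
  shows "k * 2 \<le> domination_number (G \<box> H)"
proof -
  let ?E = "{{g, g'} | g g'. (g, g') \<in> parcs G}" and ?F = "{{h, h'} | h h'. (h, h') \<in> parcs H}"
  interpret G: pair_graph G by fact
  interpret H: pair_graph H by fact
  interpret GH: pair_graph "G \<box> H" by (rule pair_graph_cartesian_product) fact+
  obtain DG where DG: "DG \<subseteq> pverts G" "card DG = k" "dominated_edges (pverts G) DG k ?E"
    by (rule dominated_edges_graph[OF G(1,3,4)])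
  obtain DH where DH: "DH \<subseteq> pverts H" "card DH = 2" "dominated_edges (pverts H) DH 2 ?F"
    by (rule dominated_edges_graph[OF H(1,3)]) auto
  obtain T where T: "dominating (G \<box> H) T" "card T = domination_number (G \<box> H)"
    by (rule domination_number_witness[OF GH.pair_finite_verts])
  have TV: "T \<subseteq> pverts G \<times> pverts H"
    using T by (simp add: dominating_def cartesian_product_def)
  have dom: "(g, h) \<in> T \<or> (\<exists>g'\<in>pverts G - {g}. {g, g'} \<in> ?E \<and> (g', h) \<in> T) \<or>
      (\<exists>h'\<in>pverts H - {h}. {h, h'} \<in> ?F \<and> (g, h') \<in> T)"
    if gh: "g \<in> pverts G" "h \<in> pverts H" for g h
  proof (cases "(g, h) \<in> T")
    case False
    \<comment> \<open>The dominating vertex lies in \<open>T\<close> while (g, h) does not, so the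
      two differ.\<close>
    then obtain g' h' where T': "(g', h') \<in> T" "((g, h), (g', h')) \<in> parcs (G \<box> H)"
      using T gh by (fastforce simp: dominating_def cartesian_product_def)
    then consider "g = g'" "(h, h') \<in> parcs H" | "h = h'" "(g, g') \<in> parcs G"
      by (auto simp: cartesian_product_def)
    then show ?thesis
    proof cases
      case 1
      then have "h' \<in> pverts H - {h}" using T' TV False by auto
      then show ?thesis using 1 T' by blast
    next
      case 2
      then have "g' \<in> pverts G - {g}" using T' TV False by auto
      then show ?thesis using 2 T' by blast
    qed
  qed simp
  have "real (k * 2) \<le> (\<Sum>g\<in>pverts G. \<Sum>h\<in>pverts H. of_bool ((g, h) \<in> T))"
    using certificate_at_point[of "\<lambda>g h. of_bool ((g, h) \<in> T)" "\<lambda>g h. (g, h) \<in> T",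
        OF refl G.pair_finite_verts DG(1,2) G(2,4) DG(3) DH(1,2) H(2) DH(3) dom]
    by (smt (verit) sum_nonneg zero_le_power2)
  also have "\<dots> = (\<Sum>w\<in>pverts G \<times> pverts H. of_bool (w \<in> T))"
    by (simp only: sum.cartesian_product split_def prod.collapse)
  also have "\<dots> = real (card T)"
    using TV by (simp add: sum.If_cases Int_absorb1 flip: Int_def)
  finally show ?thesis
    using T by linarith
qed

theorem theorem4p6:
  fixes K :: "real set"
    and VG DG :: "'a set" and VH DH :: "'b set"
    and nG kG nH kH :: nat
    and \<alpha> \<beta> \<gamma> :: real
    and s0 fstar :: "('a, 'b) vvar rpoly"
    and s :: "'a \<Rightarrow> ('a, 'b) vvar rpoly"
  assumes K: "subfield K (ring_of_type_algebra :: real ring)" "sqrt 2 \<in> K"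
    and params: "nG > 0" "kG > 0" "kG = nG - 1" "nH = 3" "kH = 2"
    and VG: "finite VG" "card VG = nG" "DG \<subseteq> VG" "card DG = kG"
    and VH: "finite VH" "card VH = nH" "DH \<subseteq> VH" "card DH = kH"
    and \<alpha>: "\<alpha> = sqrt 2 * (real nG - 1)"
    and \<beta>: "\<beta> = - (2 / 3) * sqrt 2"
    and \<gamma>: "\<gamma> = (1 / 3) * sqrt 2"
    and s0: "s0 = PConst \<alpha>
                  + PConst \<beta> * (\<Sum>g\<in>VG. \<Sum>h\<in>VH. xv g h)
                  + PConst \<gamma> * (\<Sum>g\<in>VG. \<Sum>p\<in>nsets VH 2. \<Prod>h\<in>p. xv g h)"
    and s: "\<And>g. s g = PConst (1 / 3) *
                  ((\<Sum>h\<in>VH. xv g h) - 2 * (\<Sum>p\<in>nsets VH 2. \<Prod>h\<in>p. xv g h))"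
    and fstar: "fstar = (\<Sum>g\<in>VG. \<Sum>h\<in>VH. xv g h) - of_nat (kG * kH)"
  shows "sos_certificate (vizing_ring K VG VH) (I_sos K VG DG kG VH DH kH) 2 fstar
           (insert None (Some ` VG)) (case_option s0 s)
       \<and> fstar - (s0\<^sup>2 + (\<Sum>g\<in>VG. (s g)\<^sup>2)) \<in> I_sos K VG DG kG VH DH kH
       \<and> (\<forall>(G :: 'a pair_pre_digraph) (H :: 'b pair_pre_digraph).
            pair_graph G \<and> card (pverts G) = nG \<and> domination_number G = kG \<and>
            pair_graph H \<and> card (pverts H) = nH \<and> domination_number H = kH
            \<longrightarrow> domination_number G * domination_number H \<le> domination_number (G \<box> H))"
proof -
  let ?V = "vizing_vars VG VH" and ?I = "I_sos K VG DG kG VH DH kH"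
  let ?P = "polys_over K ?V"
  note KR = subfieldE(1)[OF K(1)]
  note closed = polys_over_PConst polys_over_add[OF KR] polys_over_diff[OF KR] polys_over_mult[OF KR]
    polys_over_sum[OF KR] polys_over_prod[OF KR] polys_over_power[OF KR] polys_over_PVar[OF KR]
  note degree = total_degree_PConst total_degree_add total_degree_diff total_degree_sum
  have k: "nG = Suc kG" "card VG = Suc kG" "card DG = kG" "card VH = 3" "card DH = 2" "kH = 2"
    using params VG VH by auto
  have finH: "finite VH" using k(4) card.infinite by fastforce
  have nat: "real n \<in> K" for n by (rule real_of_nat_in_subring[OF KR])
  have "inverse 3 \<in> K" using real_subfield_inverse[OF K(1) nat[of 3]] by simp
  then have third: "1 / 3 \<in> K" by (simp add: field_simps)
  \<comment> \<open>The coefficients are written as products of naturals, 1/3 and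
    \<open>sqrt 2\<close>, all known to lie in \<open>K\<close>.\<close>
  have "\<alpha> = sqrt 2 * real kG" "\<beta> = - (real 2 * (1 / 3) * sqrt 2)" "\<gamma> = 1 / 3 * sqrt 2"
    using \<alpha> \<beta> \<gamma> k by simp_all
  then have coeffs: "\<alpha> \<in> K" "\<beta> \<in> K" "\<gamma> \<in> K"
    using nat third K(2) by (metis real_subringD(4,5)[OF KR])+
  \<comment> \<open>Numerals become explicit constants so that the closure and degree rules apply to
    them.\<close>
  have two: "2 = PConst (real 2)" and prodk: "of_nat (kG * kH) = PConst (real (kG * kH))"
    by (simp_all add: PConst_numeral PConst_of_nat del: of_nat_mult)
  have xP: "xv g h \<in> ?P" if "g \<in> VG" "h \<in> VH" for g h
    using that by (intro closed) (auto simp: vizing_vars_def)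
  have pairP: "(\<Prod>h\<in>p. xv g h) \<in> ?P" if "g \<in> VG" "p \<in> nsets VH 2" for g p
    using that by (intro closed xP) (auto simp: nsets_def)
  have s0P: "s0 \<in> ?P"
    unfolding s0 by (intro closed coeffs xP pairP)
  have sP: "s g \<in> ?P" if "g \<in> VG" for g
    unfolding s two by (intro closed third nat xP pairP that)
  have fP: "fstar \<in> ?P"
    unfolding fstar prodk by (intro closed nat xP)
  have xdeg: "total_degree (xv g h) \<le> 2" for g h
    by (rule total_degree_PVar) simp
  have pairdeg: "total_degree (\<Prod>h\<in>p. xv g h) \<le> 2" if p: "p \<in> nsets VH 2" for g p
  proof -
    obtain h h' where "p = {h, h'}" "h \<noteq> h'" using p by (auto elim: nsets2_E)
    then show ?thesis
      using total_degree_mult[of "xv g h" 1 "xv g h'" 1]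
      by (simp add: total_degree_PVar numeral_2_eq_2)
  qed
  \<comment> \<open>A constant has degree at most 0, so scaling preserves the bound 2.\<close>
  have scale: "total_degree (PConst c * p) \<le> 2" if "total_degree p \<le> 2" for c and p :: "('a, 'b) vvar rpoly"
    using total_degree_mult[OF total_degree_PConst that, of c 0] by simp
  have s0deg: "total_degree s0 \<le> 2"
    unfolding s0 by (intro degree scale xdeg pairdeg)
  have sdeg: "total_degree (s g) \<le> 2" for g
    unfolding s two by (intro degree scale xdeg pairdeg)
  have cert: "fstar - (s0\<^sup>2 + (\<Sum>g\<in>VG. (s g)\<^sup>2)) \<in> ?I"
  proof (rule boolean_nullstellensatz[OF K(1) finite_vizing_vars[OF VG(1) finH]])
    show "ideal ?I (vizing_ring K VG VH)"
      by (rule I_sos_ideal[OF KR VG(3) VH(3)])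
    show "(PVar v)\<^sup>2 - PVar v \<in> ?I" if "v \<in> ?V" for v
      using vizing_gens_boolean[OF that] I_sos_ideal(2)[OF KR VG(3) VH(3)] by (rule subsetD[rotated])
    show "fstar - (s0\<^sup>2 + (\<Sum>g\<in>VG. (s g)\<^sup>2)) \<in> ?P"
      by (intro closed fP s0P sP)
  next
    fix A assume "\<And>q. q \<in> ?I \<Longrightarrow> insertion (\<lambda>v. of_bool (v \<in> A)) q = 0"
    \<comment> \<open>\<open>A\<close> is now a Boolean zero of the ideal; it encodes two edge sets
      and a selection.\<close>
    then have zero: "insertion (\<lambda>v. of_bool (v \<in> A)) q = 0"
      if "q \<in> graph_gens eG VG DG kG \<union> graph_gens eH VH DH kH \<union> product_gens VG VH" for q
      using that I_sos_ideal(2)[OF KR VG(3) VH(3)] by blast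
    have E: "dominated_edges VG DG kG {e. EG e \<in> A}"
      by (rule dominated_edges_if_vanish[OF VG(1,3)]) (use zero in blast)
    have F: "dominated_edges VH DH 2 {e. EH e \<in> A}"
      by (rule dominated_edges_if_vanish[OF finH VH(3)]) (use zero k(6) in blast)
    have dom: "XV g h \<in> A \<or> (\<exists>g'\<in>VG - {g}. {g, g'} \<in> {e. EG e \<in> A} \<and> XV g' h \<in> A) \<or>
        (\<exists>h'\<in>VH - {h}. {h, h'} \<in> {e. EH e \<in> A} \<and> XV g h' \<in> A)" if "g \<in> VG" "h \<in> VH" for g h
      by (rule product_gens_vanish[OF VG(1) finH _ that]) (use zero in blast)
    have "real nG - 1 = real kG" using k by simp
    then show "insertion (\<lambda>v. of_bool (v \<in> A)) (fstar - (s0\<^sup>2 + (\<Sum>g\<in>VG. (s g)\<^sup>2))) = 0"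
      using certificate_at_point[of "\<lambda>g h. of_bool (XV g h \<in> A)" "\<lambda>g h. XV g h \<in> A",
          OF refl VG(1,3) k(3,2) params(2) E VH(3) k(5,4) F dom]
      unfolding fstar s0 s \<alpha> \<beta> \<gamma> k(6) insertion_simps by simp
  qed
  \<comment> \<open>The index \<open>None\<close> carries \<open>s0\<close>, and
    \<open>Some g\<close> carries \<open>s g\<close>.\<close>
  moreover have "(\<Sum>i\<in>insert None (Some ` VG). (case_option s0 s i)\<^sup>2) = s0\<^sup>2 + (\<Sum>g\<in>VG. (s g)\<^sup>2)"
    using VG(1) by (simp add: sum.reindex)
  ultimately show ?thesis
    using VG(1) s0P sP s0deg sdeg vizing_inequality[of _ kG] params(2) k(1,6) params(4)
    by (auto simp: sos_certificate_def mpoly_ring_simps)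
qed

end
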